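(* Let $(X,\mathcal{A},\mu)$ be a measure space with $\mu(X)>0$ such that $X$ is not an atom. Let $V\subseteq\mathscr{D}$ be a set of distinct class representatives for the equivalence relation $\sim$ on $\mathscr{D}$, all of whose elements are characteristic functions. If $|[1_A]|=|[1_{X\setminus A}]|$ for each $1_A\in V$, then the zero-divisor graph $\Gamma(\mathcal{M}(X,\mathcal{A}))$ and the comaximal graph $\Gamma'_2(\mathcal{M}(X,\mathcal{A}))$ are isomorphic as graphs.
   Context: $\mathcal{M}(X,\mathcal{A})$ is the commutative ring (pointwise operations) of all $\mathcal{A}$-measurable functions $f:X\to\mathbb{R}$; $Z(f)=\{x\in X:f(x)=0\}$; $1_A$ is the characteristic function of $A$; $|\cdot|$ denotes cardinality. A set $A\in\mathcal{A}$ is an atom if $\mu(A)>0$ and $A$ cannot be written as a disjoint union $A=B\sqcup C$ with $B,C\in\mathcal{A}$, $\mu(B)>0$, $\mu(C)>0$. A function $u$ is a $\mu$-unit if $\mu(Z(u))=0$. Write $\mathscr{D}=\{f\in\mathcal{M}(X,\mathcal{A}):\mu(Z(f))>0\text{ and }\mu(X\setminus Z(f))>0\}$. The zero-divisor graph $\Gamma(\mathcal{M}(X,\mathcal{A}))$ is the simple graph with vertex set $\mathscr{D}$ in which distinct $f,g$ are adjacent iff $\mu((X\setminus Z(f))\cap(X\setminus Z(g)))=0$. The comaximal graph $\Gamma'_2(\mathcal{M}(X,\mathcal{A}))$ is the simple graph with vertex set $\mathscr{D}$ in which distinct $f,g$ are adjacent iff $\langle f\rangle+\langle g\rangle=\langle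 u\rangle$ (sum of principal ideals) for some $\mu$-unit $u$. The relation $\sim$ on $\mathscr{D}$ is: $f\sim g$ iff $\mu(Z(f)\triangle Z(g))=0$; $[f]\subseteq\mathscr{D}$ denotes the $\sim$-class of $f$. The set $V$ contains exactly one element of each $\sim$-class, and each element has the form $1_A$ with $A\in\mathcal{A}$, $\mu(A)>0$, $\mu(X\setminus A)>0$. A graph isomorphism is a bijection of vertex sets preserving adjacency in both directions. *)

theory Defs
  imports "HOL-Analysis.Analysis" "HOL-Algebra.Ideal" "HOL-Library.Equipollence"
begin

text \<open>Members are extensional (\<open>undefined\<close> outside \<open>space M\<close>), so that HOL equality of members is
  equality of functions on \<open>space M\<close>. Otherwise cardinalities of sets of measurable functions would
  also count the irrelevant values outside the space.\<close>

definition meas_ring :: "'a measure \<Rightarrow> ('a \<Rightarrow> real) ring" where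
  "meas_ring M =
    \<lparr> carrier = borel_measurable M \<inter> extensional (space M),
      mult = (\<lambda>f g. \<lambda>x\<in>space M. f x * g x),
      one = (\<lambda>x\<in>space M. 1),
      ring.zero = (\<lambda>x\<in>space M. 0),
      ring.add = (\<lambda>f g. \<lambda>x\<in>space M. f x + g x) \<rparr>"

lemma cring_meas_ring: "cring (meas_ring M)"
proof (rule cringI)
  show "abelian_group (meas_ring M)"
  proof (rule abelian_groupI)
    fix f assume f: "f \<in> carrier (meas_ring M)"
    show "\<exists>g\<in>carrier (meas_ring M). g \<oplus>\<^bsub>meas_ring M\<^esub> f = \<zero>\<^bsub>meas_ring M\<^esub>"
      using f by (intro bexI[of _ "\<lambda>x\<in>space M. - f x"]) (auto simp: meas_ring_def fun_eq_iff cong: measurable_cong)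
  qed (auto simp: meas_ring_def fun_eq_iff extensional_def cong: measurable_cong)
  show "comm_monoid (meas_ring M)"
    by (rule comm_monoidI) (auto simp: meas_ring_def fun_eq_iff extensional_def cong: measurable_cong)
qed (auto simp: meas_ring_def fun_eq_iff algebra_simps)

definition zero_set :: "'a measure \<Rightarrow> ('a \<Rightarrow> real) \<Rightarrow> 'a set" where
  "zero_set M f = {x \<in> space M. f x = 0}"

definition char_fun :: "'a measure \<Rightarrow> 'a set \<Rightarrow> 'a \<Rightarrow> real" where
  "char_fun M A = restrict (indicator A) (space M)"

definition is_atom :: "'a measure \<Rightarrow> 'a set \<Rightarrow> bool" where
  "is_atom M A \<longleftrightarrow> A \<in> sets M \<and> emeasure M A > 0 \<and>
    \<not> (\<exists>B\<in>sets M. \<exists>C\<in>sets M. A = B \<union> C \<and> B \<inter> C = {} \<and> emeasure M B > 0 \<and> emeasure M C > 0)"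

definition mu_unit :: "'a measure \<Rightarrow> ('a \<Rightarrow> real) \<Rightarrow> bool" where
  "mu_unit M u \<longleftrightarrow> u \<in> carrier (meas_ring M) \<and> emeasure M (zero_set M u) = 0"

definition graph_vertices :: "'a measure \<Rightarrow> ('a \<Rightarrow> real) set" where
  "graph_vertices M = {f \<in> carrier (meas_ring M).
     emeasure M (zero_set M f) > 0 \<and> emeasure M (space M - zero_set M f) > 0}"

text \<open>A simple graph is a vertex set together with a set of two-element sets of vertices.\<close>

record 'v simple_graph =
  vertices :: "'v set"
  edges :: "'v set set"

definition graph_isomorphic :: "'v simple_graph \<Rightarrow> 'w simple_graph \<Rightarrow> bool" where
  "graph_isomorphic G H \<longleftrightarrow> (\<exists>\<phi>. bij_betw \<phi> (vertices G) (vertices H) \<and>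
     (\<forall>v\<in>vertices G. \<forall>w\<in>vertices G. {v, w} \<in> edges G \<longleftrightarrow> {\<phi> v, \<phi> w} \<in> edges H))"

definition zero_divisor_graph :: "'a measure \<Rightarrow> ('a \<Rightarrow> real) simple_graph" where
  "zero_divisor_graph M =
    \<lparr> vertices = graph_vertices M,
      edges = {{f, g} | f g. f \<in> graph_vertices M \<and> g \<in> graph_vertices M \<and> f \<noteq> g \<and>
        emeasure M ((space M - zero_set M f) \<inter> (space M - zero_set M g)) = 0} \<rparr>"

definition comaximal_graph :: "'a measure \<Rightarrow> ('a \<Rightarrow> real) simple_graph" where
  "comaximal_graph M =
    \<lparr> vertices = graph_vertices M,
      edges = {{f, g} | f g. f \<in> graph_vertices M \<and> g \<in> graph_vertices M \<and> f \<noteq> g \<and>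
        (\<exists>u. mu_unit M u \<and>
          PIdl\<^bsub>meas_ring M\<^esub> f <+>\<^bsub>meas_ring M\<^esub> PIdl\<^bsub>meas_ring M\<^esub> g = PIdl\<^bsub>meas_ring M\<^esub> u)} \<rparr>"

definition zero_set_rel :: "'a measure \<Rightarrow> (('a \<Rightarrow> real) \<times> ('a \<Rightarrow> real)) set" where
  "zero_set_rel M = {(f, g). f \<in> graph_vertices M \<and> g \<in> graph_vertices M \<and>
     emeasure M (sym_diff (zero_set M f) (zero_set M g)) = 0}"

definition char_representatives :: "'a measure \<Rightarrow> ('a \<Rightarrow> real) set \<Rightarrow> bool" where
  "char_representatives M V \<longleftrightarrow>
     V \<subseteq> graph_vertices M \<and>
     (\<forall>K \<in> graph_vertices M // zero_set_rel M. \<exists>!v. v \<in> V \<and> v \<in> K) \<and>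
     (\<forall>v\<in>V. \<exists>A\<in>sets M. v = char_fun M A \<and> emeasure M A > 0 \<and> emeasure M (space M - A) > 0)"

end

(* Two members of the ring generate a principal ideal spanned by a mu-unit exactly when their zero sets
   meet in a null set: <f> + <g> is always the ideal of f^2 + g^2. So adjacency in the comaximal graph is
   adjacency in the zero-divisor graph with zero sets replaced by their complements. Complementation is an
   involution on the classes of vertices; the cardinality hypothesis provides a bijection from each class onto
   its complementary class, and the union of these bijections is an isomorphism of the graphs. *)

theory Submission imports Defs begin

section \<open>Gluing bijections between equivalence classes\<close>

text \<open>One bijection is chosen per class, from the class of \<open>f\<close> onto the class of
  \<open>c f\<close>, and these are glued. Since \<open>c\<close> induces an involution on classes,
  distinct sources have distinct targets and every class is a target.\<close>

lemma bij_betw_from_class_eqpoll: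
  assumes R: "equiv D R"
    and c: "\<And>f. f \<in> D \<Longrightarrow> c f \<in> D"
    and cong: "\<And>f g. (f, g) \<in> R \<Longrightarrow> (c f, c g) \<in> R"
    and invol: "\<And>f. f \<in> D \<Longrightarrow> (c (c f), f) \<in> R"
    and eqp: "\<And>f. f \<in> D \<Longrightarrow> R `` {f} \<approx> R `` {c f}"
  obtains \<phi> where "bij_betw \<phi> D D" "\<And>f. f \<in> D \<Longrightarrow> (c f, \<phi> f) \<in> R"
proof -
  have symR: "\<And>f g. (f, g) \<in> R \<Longrightarrow> (g, f) \<in> R"
    and transR: "\<And>f g h. (f, g) \<in> R \<Longrightarrow> (g, h) \<in> R \<Longrightarrow> (f, h) \<in> R"
    and reflR: "\<And>f. f \<in> D \<Longrightarrow> (f, f) \<in> R"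
    and inD: "\<And>f g. (f, g) \<in> R \<Longrightarrow> f \<in> D \<and> g \<in> D"
    using R by (auto simp: equiv_def dest: symD transD refl_onD)
  have class_eq: "R `` {f} = R `` {g}" if "(f, g) \<in> R" for f g
    using that R by (simp add: equiv_class_eq)
  \<comment> \<open>The map induced by \<open>c\<close> on classes. By \<open>cong\<close> all
    members of the union coincide, so no representative has to be picked.\<close>
  define C where "C K = (\<Union>f\<in>K. R `` {c f})" for K
  have C: "C (R `` {f}) = R `` {c f}" if "f \<in> D" for f
    unfolding C_def using class_eq[OF cong] reflR[OF that] by blast
  \<comment> \<open>The choice depends on the class alone, so equivalent elements are moved by the
    same bijection; injectivity within a class rests on this.\<close>
  define h where "h K = (SOME p. bij_betw p K (C K))" for K
  have h: "bij_betw (h (R `` {f})) (R `` {f}) (R `` {c f})" if "f \<in> D" for f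
    using eqp[OF that] someI_ex[of "\<lambda>p. bij_betw p (R `` {f}) (R `` {c f})"]
    by (simp add: h_def C[OF that] eqpoll_def)
  define \<phi> where "\<phi> f = h (R `` {f}) f" for f
  have \<phi>: "(c f, \<phi> f) \<in> R" if "f \<in> D" for f
    using bij_betwE[OF h[OF that]] reflR[OF that] by (simp add: \<phi>_def)
  have "inj_on \<phi> D"
  proof (rule inj_onI)
    fix f g assume f: "f \<in> D" and g: "g \<in> D" and eq: "\<phi> f = \<phi> g"
    have "(c f, c g) \<in> R"
      using \<phi>[OF f] \<phi>[OF g] eq symR transR by metis
    \<comment> \<open>Applying \<open>c\<close> once more relates \<open>c (c f)\<close> to
      \<open>c (c g)\<close>, that is, \<open>f\<close> to \<open>g\<close>.\<close>
    then have fg: "(f, g) \<in> R"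
      using cong invol[OF f] invol[OF g] symR transR by meson
    have "h (R `` {f}) f = h (R `` {f}) g"
      using eq class_eq[OF fg] by (simp add: \<phi>_def)
    then show "f = g"
      using h[OF f] reflR[OF f] fg by (auto simp: bij_betw_def dest: inj_onD)
  qed
  moreover have "\<phi> ` D = D"
  proof
    show "\<phi> ` D \<subseteq> D" using \<phi> inD by blast
    show "D \<subseteq> \<phi> ` D"
    proof
      fix g assume g: "g \<in> D"
      \<comment> \<open>The class of \<open>g\<close> is the target of the bijection attached to the
        class of \<open>c g\<close>, so a preimage is to be found there.\<close>
      have "g \<in> R `` {c (c g)}" using invol[OF g] by simp
      then obtain f where f: "(c g, f) \<in> R" and gf: "g = h (R `` {c g}) f"
        using h[OF c[OF g]] unfolding bij_betw_def by blast
      have "g = \<phi> f" using gf class_eq[OF f] by (simp add: \<phi>_def)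
      then show "g \<in> \<phi> ` D" using inD[OF f] by blast
    qed
  qed
  ultimately show thesis using that \<phi> by (auto simp: bij_betw_def)
qed

section \<open>Null-set conditions as almost-everywhere statements\<close>

lemma graph_vertices_iff_AE:
  "f \<in> graph_vertices M \<longleftrightarrow> f \<in> carrier (meas_ring M) \<and>
     \<not> (AE x in M. f x \<noteq> 0) \<and> \<not> (AE x in M. f x = 0)"
proof (cases "f \<in> carrier (meas_ring M)")
  case True
  then have [measurable]: "f \<in> borel_measurable M" by (simp add: meas_ring_def)
  have "(AE x in M. f x \<noteq> 0) \<longleftrightarrow> emeasure M (zero_set M f) = 0"
    by (rule AE_iff_measurable) (auto simp: zero_set_def)
  moreover have "(AE x in M. f x = 0) \<longleftrightarrow> emeasure M (space M - zero_set M f) = 0"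
    by (rule AE_iff_measurable) (auto simp: zero_set_def)
  ultimately show ?thesis
    by (simp add: graph_vertices_def True zero_less_iff_neq_zero)
qed (simp add: graph_vertices_def)

lemma graph_verticesD:
  assumes "f \<in> graph_vertices M"
  shows "f \<in> carrier (meas_ring M)" "f \<in> borel_measurable M"
  using assms by (auto simp: graph_vertices_def meas_ring_def)

lemma zero_set_rel_iff_AE:
  "(f, g) \<in> zero_set_rel M \<longleftrightarrow> f \<in> graph_vertices M \<and> g \<in> graph_vertices M \<and>
     (AE x in M. f x = 0 \<longleftrightarrow> g x = 0)"
proof (cases "f \<in> graph_vertices M \<and> g \<in> graph_vertices M")
  case True
  then have [measurable]: "f \<in> borel_measurable M" "g \<in> borel_measurable M"
    by (auto dest: graph_verticesD)
  have "(AE x in M. f x = 0 \<longleftrightarrow> g x = 0) \<longleftrightarrow> emeasure M (sym_diff (zero_set M f) (zero_set M g)) = 0"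
    by (rule AE_iff_measurable) (auto simp: zero_set_def)
  then show ?thesis by (simp add: zero_set_rel_def True)
qed (auto simp: zero_set_rel_def)

lemma equiv_zero_set_rel: "equiv (graph_vertices M) (zero_set_rel M)"
proof (rule equivI)
  show "zero_set_rel M \<subseteq> graph_vertices M \<times> graph_vertices M"
    by (auto simp: zero_set_rel_def)
  show "refl_on (graph_vertices M) (zero_set_rel M)"
    by (auto simp: refl_on_def zero_set_rel_iff_AE)
  show "sym (zero_set_rel M)"
    by (auto simp: sym_def zero_set_rel_iff_AE)
  show "trans (zero_set_rel M)"
    by (auto simp: trans_def zero_set_rel_iff_AE)
qed

lemma zero_divisor_edge_iff:
  assumes "f \<in> graph_vertices M" "g \<in> graph_vertices M"
  shows "{f, g} \<in> edges (zero_divisor_graph M) \<longleftrightarrow> f \<noteq> g \<and> (AE x in M. f x = 0 \<or> g x = 0)"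
proof -
  have [measurable]: "f \<in> borel_measurable M" "g \<in> borel_measurable M"
    using assms by (auto dest: graph_verticesD)
  have "(AE x in M. f x = 0 \<or> g x = 0) \<longleftrightarrow>
      emeasure M ((space M - zero_set M f) \<inter> (space M - zero_set M g)) = 0"
    by (rule AE_iff_measurable) (auto simp: zero_set_def)
  then show ?thesis
    using assms by (auto simp: zero_divisor_graph_def doubleton_eq_iff Int_commute)
qed

section \<open>Sums of principal ideals and comaximal adjacency\<close>

text \<open>A real sum of squares vanishes only where both terms do, so every combination of
  \<open>f\<close> and \<open>g\<close> can be divided by it pointwise, and the quotient stays
  measurable.\<close>

lemma ideal_sum_eq_PIdl_sum_squares:
  assumes f: "f \<in> carrier (meas_ring M)" and g: "g \<in> carrier (meas_ring M)"
  shows "PIdl\<^bsub>meas_ring M\<^esub> f <+>\<^bsub>meas_ring M\<^esub> PIdl\<^bsub>meas_ring M\<^esub> g =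
    PIdl\<^bsub>meas_ring M\<^esub> (\<lambda>x\<in>space M. (f x)\<^sup>2 + (g x)\<^sup>2)" (is "?L = PIdl\<^bsub>?R\<^esub> ?u")
proof -
  have [measurable]: "f \<in> borel_measurable M" "g \<in> borel_measurable M"
    using f g by (auto simp: meas_ring_def)
  have mem_L: "z \<in> ?L \<longleftrightarrow> (\<exists>a\<in>carrier ?R. \<exists>b\<in>carrier ?R. z = a \<otimes>\<^bsub>?R\<^esub> f \<oplus>\<^bsub>?R\<^esub> b \<otimes>\<^bsub>?R\<^esub> g)" for z
    by (auto simp: set_add_def' cgenideal_def)
  show ?thesis
  proof
    show "?L \<subseteq> PIdl\<^bsub>?R\<^esub> ?u"
    proof
      fix z assume "z \<in> ?L"
      then obtain a b where a: "a \<in> carrier ?R" and b: "b \<in> carrier ?R"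
        and z: "z = a \<otimes>\<^bsub>?R\<^esub> f \<oplus>\<^bsub>?R\<^esub> b \<otimes>\<^bsub>?R\<^esub> g" unfolding mem_L by blast
      have [measurable]: "a \<in> borel_measurable M" "b \<in> borel_measurable M"
        using a b by (auto simp: meas_ring_def)
      (* Where f and g both vanish the quotient is the junk value 0, and z vanishes there as well. *)
      define q where "q = (\<lambda>x\<in>space M. (a x * f x + b x * g x) / ((f x)\<^sup>2 + (g x)\<^sup>2))"
      have "q \<in> carrier ?R" by (simp add: q_def meas_ring_def cong: measurable_cong)
      moreover have "z = q \<otimes>\<^bsub>?R\<^esub> ?u"
        by (auto simp: z q_def meas_ring_def fun_eq_iff sum_power2_eq_zero_iff)
      ultimately show "z \<in> PIdl\<^bsub>?R\<^esub> ?u" by (auto simp: cgenideal_def)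
    qed
    show "PIdl\<^bsub>?R\<^esub> ?u \<subseteq> ?L"
    proof
      fix z assume "z \<in> PIdl\<^bsub>?R\<^esub> ?u"
      then obtain q where q: "q \<in> carrier ?R" and z: "z = q \<otimes>\<^bsub>?R\<^esub> ?u"
        by (auto simp: cgenideal_def)
      interpret cring ?R by (rule cring_meas_ring)
      have "z = (q \<otimes>\<^bsub>?R\<^esub> f) \<otimes>\<^bsub>?R\<^esub> f \<oplus>\<^bsub>?R\<^esub> (q \<otimes>\<^bsub>?R\<^esub> g) \<otimes>\<^bsub>?R\<^esub> g"
        by (auto simp: z meas_ring_def fun_eq_iff power2_eq_square algebra_simps)
      then show "z \<in> ?L" unfolding mem_L using q f g m_closed by blast
    qed
  qed
qed

text \<open>A generator \<open>u\<close> is a multiple of the sum of squares, so it vanishes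
  wherever \<open>f\<close> and \<open>g\<close> both do; if \<open>u\<close> is a
  \<open>mu_unit\<close>, this common zero set is null. Conversely, the sum of squares is itself the
  required \<open>mu_unit\<close>.\<close>

lemma ideal_sum_eq_PIdl_mu_unit_iff_AE:
  assumes f: "f \<in> carrier (meas_ring M)" and g: "g \<in> carrier (meas_ring M)"
  shows "(\<exists>u. mu_unit M u \<and>
      PIdl\<^bsub>meas_ring M\<^esub> f <+>\<^bsub>meas_ring M\<^esub> PIdl\<^bsub>meas_ring M\<^esub> g = PIdl\<^bsub>meas_ring M\<^esub> u) \<longleftrightarrow>
    (AE x in M. f x \<noteq> 0 \<or> g x \<noteq> 0)" (is "?L \<longleftrightarrow> ?R")
proof -
  have [measurable]: "f \<in> borel_measurable M" "g \<in> borel_measurable M"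
    using f g by (auto simp: meas_ring_def)
  let ?s = "\<lambda>x\<in>space M. (f x)\<^sup>2 + (g x)\<^sup>2"
  have s: "?s \<in> carrier (meas_ring M)"
    by (simp add: meas_ring_def cong: measurable_cong)
  have AE_iff: "?R \<longleftrightarrow> emeasure M (zero_set M ?s) = 0"
    by (rule AE_iff_measurable) (auto simp: zero_set_def sum_power2_eq_zero_iff)
  show ?thesis
  proof
    assume ?L
    then obtain u where u: "mu_unit M u" and eq: "PIdl\<^bsub>meas_ring M\<^esub> ?s = PIdl\<^bsub>meas_ring M\<^esub> u"
      using ideal_sum_eq_PIdl_sum_squares[OF f g] by metis
    interpret cring "meas_ring M" by (rule cring_meas_ring)
    have uc: "u \<in> carrier (meas_ring M)" using u by (simp add: mu_unit_def)
    then obtain q where "u = q \<otimes>\<^bsub>meas_ring M\<^esub> ?s"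
      using cgenideal_self[OF uc] eq by (auto simp: cgenideal_def)
    then have "zero_set M ?s \<subseteq> zero_set M u"
      by (auto simp: zero_set_def meas_ring_def)
    moreover have "zero_set M u \<in> sets M"
      using uc by (auto simp: zero_set_def meas_ring_def)
    ultimately show ?R
      using u emeasure_mono[of "zero_set M ?s" "zero_set M u" M] by (simp add: AE_iff[simplified] mu_unit_def)
  next
    assume ?R
    then have "mu_unit M ?s" using s by (simp only: AE_iff mu_unit_def simp_thms)
    then show ?L using ideal_sum_eq_PIdl_sum_squares[OF f g] by blast
  qed
qed

lemma comaximal_edge_iff:
  assumes "f \<in> graph_vertices M" "g \<in> graph_vertices M"
  shows "{f, g} \<in> edges (comaximal_graph M) \<longleftrightarrow> f \<noteq> g \<and> (AE x in M. f x \<noteq> 0 \<or> g x \<noteq> 0)"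
proof -
  \<comment> \<open>The ideal condition is translated for arbitrary endpoints first; the resulting
    condition is visibly symmetric, so the order of the pair does not matter.\<close>
  have "{f, g} \<in> edges (comaximal_graph M) \<longleftrightarrow> (\<exists>f' g'. {f, g} = {f', g'} \<and>
      f' \<in> graph_vertices M \<and> g' \<in> graph_vertices M \<and> f' \<noteq> g' \<and> (AE x in M. f' x \<noteq> 0 \<or> g' x \<noteq> 0))"
    by (auto simp: comaximal_graph_def ideal_sum_eq_PIdl_mu_unit_iff_AE graph_verticesD(1)
        cong: conj_cong)
  also have "\<dots> \<longleftrightarrow> f \<noteq> g \<and> (AE x in M. f x \<noteq> 0 \<or> g x \<noteq> 0)"
    using assms by (auto simp: doubleton_eq_iff disj_commute)
  finally show ?thesis .
qed

section \<open>Complementary vertices and their classes\<close>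

lemma char_fun_in_carrier: "A \<in> sets M \<Longrightarrow> char_fun M A \<in> carrier (meas_ring M)"
  by (simp add: char_fun_def meas_ring_def cong: measurable_cong)

lemma char_fun_eq_0_iff: "x \<in> space M \<Longrightarrow> char_fun M A x = 0 \<longleftrightarrow> x \<notin> A"
  by (simp add: char_fun_def indicator_def)

lemma AE_char_fun_zero_set: "AE x in M. char_fun M (zero_set M f) x = 0 \<longleftrightarrow> f x \<noteq> 0"
  by (rule AE_I2) (simp add: char_fun_eq_0_iff zero_set_def)

text \<open>Complementing the zero set swaps the two non-nullity conditions on a vertex.\<close>

lemma complement_in_graph_vertices:
  assumes f: "f \<in> graph_vertices M" and g: "g \<in> carrier (meas_ring M)"
    and compl: "AE x in M. g x = 0 \<longleftrightarrow> f x \<noteq> 0"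
  shows "g \<in> graph_vertices M"
proof -
  have "(AE x in M. g x \<noteq> 0) \<longleftrightarrow> (AE x in M. f x = 0)" "(AE x in M. g x = 0) \<longleftrightarrow> (AE x in M. f x \<noteq> 0)"
    using compl by (auto)
  then show ?thesis using f g by (simp add: graph_vertices_iff_AE)
qed

lemma char_fun_zero_set_in_graph_vertices:
  assumes "f \<in> graph_vertices M"
  shows "char_fun M (zero_set M f) \<in> graph_vertices M"
proof (rule complement_in_graph_vertices[OF assms char_fun_in_carrier AE_char_fun_zero_set])
  show "zero_set M f \<in> sets M"
    using graph_verticesD(2)[OF assms] by (auto simp: zero_set_def)
qed

lemma char_fun_zero_set_rel_iff:
  assumes "f \<in> graph_vertices M"
  shows "(char_fun M (zero_set M f), g) \<in> zero_set_rel M \<longleftrightarrow>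
    g \<in> graph_vertices M \<and> (AE x in M. g x = 0 \<longleftrightarrow> f x \<noteq> 0)"
proof -
  have "(AE x in M. char_fun M (zero_set M f) x = 0 \<longleftrightarrow> g x = 0) \<longleftrightarrow> (AE x in M. g x = 0 \<longleftrightarrow> f x \<noteq> 0)"
    by (rule AE_cong) (auto simp: char_fun_eq_0_iff zero_set_def)
  then show ?thesis
    by (simp add: zero_set_rel_iff_AE char_fun_zero_set_in_graph_vertices[OF assms])
qed

text \<open>Extends the cardinality hypothesis from the representatives in \<open>V\<close> to all
  vertices: both classes depend only on the class of \<open>f\<close>, which contains some
  representative.\<close>

lemma class_eqpoll_complement_class:
  assumes V: "char_representatives M V"
    and eqp: "\<forall>A\<in>sets M. char_fun M A \<in> V \<longrightarrow>
      zero_set_rel M `` {char_fun M A} \<approx> zero_set_rel M `` {char_fun M (space M - A)}"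
    and f: "f \<in> graph_vertices M"
  shows "zero_set_rel M `` {f} \<approx> zero_set_rel M `` {char_fun M (zero_set M f)}"
proof -
  have "zero_set_rel M `` {f} \<in> graph_vertices M // zero_set_rel M"
    using f by (rule quotientI)
  then obtain v where v: "v \<in> V" "(f, v) \<in> zero_set_rel M"
    using V by (auto simp: char_representatives_def)
  moreover obtain A where "A \<in> sets M" "v = char_fun M A"
    using V v(1) by (auto simp: char_representatives_def)
  ultimately have A: "A \<in> sets M" "char_fun M A \<in> V" and rel: "(f, char_fun M A) \<in> zero_set_rel M"
    by simp_all
  have D: "char_fun M A \<in> graph_vertices M"
    using rel by (simp add: zero_set_rel_iff_AE)
  have compl: "AE x in M. char_fun M (space M - A) x = 0 \<longleftrightarrow> char_fun M A x \<noteq> 0"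
    by (rule AE_I2) (simp add: char_fun_eq_0_iff)
  have "char_fun M (space M - A) \<in> carrier (meas_ring M)"
    using A(1) by (intro char_fun_in_carrier) simp
  then have "char_fun M (space M - A) \<in> graph_vertices M"
    using compl by (rule complement_in_graph_vertices[OF D])
  moreover have "AE x in M. f x = 0 \<longleftrightarrow> char_fun M A x = 0"
    using rel by (simp add: zero_set_rel_iff_AE)
  with compl have "AE x in M. char_fun M (space M - A) x = 0 \<longleftrightarrow> f x \<noteq> 0"
    by eventually_elim simp
  \<comment> \<open>Both functions vanish, up to a null set, exactly where \<open>f\<close> does
    not.\<close>
  ultimately have "(char_fun M (zero_set M f), char_fun M (space M - A)) \<in> zero_set_rel M"
    by (simp add: char_fun_zero_set_rel_iff[OF f])
  from equiv_class_eq[OF equiv_zero_set_rel this] equiv_class_eq[OF equiv_zero_set_rel rel]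
  show ?thesis using eqp A by simp
qed

theorem theorem3p34:
  fixes M :: "'a measure" and V :: "('a \<Rightarrow> real) set"
  assumes "emeasure M (space M) > 0"
    and "\<not> is_atom M (space M)"
    and "char_representatives M V"
    and "\<forall>A\<in>sets M. char_fun M A \<in> V \<longrightarrow>
      zero_set_rel M `` {char_fun M A} \<approx> zero_set_rel M `` {char_fun M (space M - A)}"
  shows "graph_isomorphic (zero_divisor_graph M) (comaximal_graph M)"
proof -
  let ?D = "graph_vertices M" and ?c = "\<lambda>f. char_fun M (zero_set M f)"
  obtain \<phi> where bij: "bij_betw \<phi> ?D ?D"
    and \<phi>: "\<And>f. f \<in> ?D \<Longrightarrow> (?c f, \<phi> f) \<in> zero_set_rel M"
  proof (rule bij_betw_from_class_eqpoll[OF equiv_zero_set_rel, of M ?c])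
    show "?c f \<in> ?D" if "f \<in> ?D" for f
      using that by (rule char_fun_zero_set_in_graph_vertices)
    show "zero_set_rel M `` {f} \<approx> zero_set_rel M `` {?c f}" if "f \<in> ?D" for f
      using assms(3,4) that by (rule class_eqpoll_complement_class)
    \<comment> \<open>The function \<open>?c (?c f)\<close> has the zero set of \<open>f\<close> but
      takes only the values 0 and 1, so the involution holds only on classes.\<close>
    show "(?c (?c f), f) \<in> zero_set_rel M" if "f \<in> ?D" for f
      using that AE_char_fun_zero_set[of M f]
      by (auto simp: char_fun_zero_set_rel_iff char_fun_zero_set_in_graph_vertices)
    show "(?c f, ?c g) \<in> zero_set_rel M" if "(f, g) \<in> zero_set_rel M" for f g
      using that AE_char_fun_zero_set[of M g]
      by (auto simp: zero_set_rel_iff_AE[of f g] char_fun_zero_set_rel_iff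
          char_fun_zero_set_in_graph_vertices)
  qed blast
  have edge: "{f, g} \<in> edges (zero_divisor_graph M) \<longleftrightarrow> {\<phi> f, \<phi> g} \<in> edges (comaximal_graph M)"
    if f: "f \<in> ?D" and g: "g \<in> ?D" for f g
  proof -
    have "\<phi> f \<in> ?D" "AE x in M. \<phi> f x = 0 \<longleftrightarrow> f x \<noteq> 0" "\<phi> g \<in> ?D" "AE x in M. \<phi> g x = 0 \<longleftrightarrow> g x \<noteq> 0"
      using \<phi>[OF f] \<phi>[OF g] by (auto simp: char_fun_zero_set_rel_iff f g)
    moreover from this have "(AE x in M. f x = 0 \<or> g x = 0) \<longleftrightarrow> (AE x in M. \<phi> f x \<noteq> 0 \<or> \<phi> g x \<noteq> 0)"
      by (auto)
    \<comment> \<open>Both graphs are loopless, so distinctness of endpoints must be transported as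
      well.\<close>
    moreover have "f = g \<longleftrightarrow> \<phi> f = \<phi> g"
      using bij f g by (auto simp: bij_betw_def dest: inj_onD)
    ultimately show ?thesis
      by (simp add: zero_divisor_edge_iff[OF f g] comaximal_edge_iff)
  qed
  show ?thesis
    unfolding graph_isomorphic_def
    using bij edge by (auto simp: zero_divisor_graph_def comaximal_graph_def)
qed

end
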